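(* Let $f\in\mathrm{Homeo}_0(\mathbb{T}^2)$, let $F:\mathbb{R}^2\to\mathbb{R}^2$ be a lift of $f$, and suppose that $\rho(F)$ has non-empty interior. (a) If $f$ is non-wandering, then no point in $\mathcal{C}(f)$ is $\frac12$-Lyapunov stable. (b) If $f$ is area-preserving, $U\subseteq\mathbb{T}^2$ is a connected and bounded neighbourhood of a point $z\in\mathcal{C}(f)$ and $\widehat U$ is a connected component of $\pi^{-1}(U)$, then $$\limsup_{n\to\infty}\ \frac1n\,\mathrm{diam}\big(F^n(\widehat U)\big)>0 .$$
   Context: $\mathbb{T}^2=\mathbb{R}^2/\mathbb{Z}^2$, $\pi:\mathbb{R}^2\to\mathbb{T}^2$ is the canonical projection, and $\mathrm{Homeo}_0(\mathbb{T}^2)$ is the set of homeomorphisms of $\mathbb{T}^2$ homotopic to the identity. For a lift $F$ of $f\in\mathrm{Homeo}_0(\mathbb{T}^2)$ the rotation set is $$\rho(F)=\{\rho\in\mathbb{R}^2 : \exists\, n_i\nearrow\infty,\ z_i\in\mathbb{R}^2 \text{ with } \lim_{i\to\infty}(F^{n_i}(z_i)-z_i)/n_i=\rho\},$$ and for $U\subseteq\mathbb{T}^2$ the rotation subset on $U$ is $$\rho_U(F)=\{\rho\in\mathbb{R}^2 : \exists\, n_i\nearrow\infty,\ z_i\in\pi^{-1}(U) \text{ with } \lim_{i\to\infty}(F^{n_i}(z_i)-z_i)/n_i=\rho\}.$$ The chaotic region of $f$ is $$\mathcal{C}(f)=\{z\in\mathbb{T}^2 : \mathrm{int}(\mathrm{Conv}(\rho_U(F)))\neq\emptyset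 \text{ for all open neighbourhoods } U \text{ of } z\},$$ where $\mathrm{Conv}$ denotes the convex hull and $\mathrm{int}$ the interior (this does not depend on the choice of the lift $F$). $U\subseteq\mathbb{T}^2$ is bounded if the connected components of $\pi^{-1}(U)$ are bounded in $\mathbb{R}^2$. A set $U\subseteq\mathbb{T}^2$ is wandering if $f^n(U)\cap U=\emptyset$ for all $n\geq 1$; a point is wandering if it is contained in some wandering open set, and non-wandering otherwise; $f$ is non-wandering if all points of $\mathbb{T}^2$ are non-wandering. Area-preserving means preserving Lebesgue measure on $\mathbb{T}^2$. A point $z\in\mathbb{T}^2$ is $\varepsilon$-Lyapunov stable if there exists $\delta>0$ such that $f^n(B_\delta(z))\subseteq B_\varepsilon(f^n(z))$ for all $n\in\mathbb{N}$, where $B_r$ denotes the ball of radius $r$.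
   Formalization: In (b), if the neighbourhood U is not open, the component Û is required to contain a lift of z; without this the claim fails, since for some non-open connected bounded U a component of π⁻¹(U) can be a single point. *)

theory Defs
  imports "HOL-Analysis.Analysis"
begin

section \<open>The flat torus\<close>

quotient_type torus = "real^2" / "\<lambda>x y. \<forall>i. x $ i - y $ i \<in> \<int>"
  morphisms torus_rep torus_proj
proof (rule equivpI)
  show "reflp (\<lambda>x y :: real^2. \<forall>i. x $ i - y $ i \<in> \<int>)"
    by (auto intro: reflpI)
  show "symp (\<lambda>x y :: real^2. \<forall>i. x $ i - y $ i \<in> \<int>)"
    by (intro sympI) (metis Ints_minus minus_diff_eq)
  show "transp (\<lambda>x y :: real^2. \<forall>i. x $ i - y $ i \<in> \<int>)"
  proof (intro transpI allI)
    fix x y z :: "real^2" and i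
    assume "\<forall>i. x $ i - y $ i \<in> \<int>" "\<forall>i. y $ i - z $ i \<in> \<int>"
    then have "(x $ i - y $ i) + (y $ i - z $ i) \<in> \<int>" by (intro Ints_add) auto
    then show "x $ i - z $ i \<in> \<int>" by simp
  qed
qed

lemma torus_proj_eq_iff: "torus_proj x = torus_proj y \<longleftrightarrow> (\<forall>i. x $ i - y $ i \<in> \<int>)"
  by (rule torus.abs_eq_iff)

lemma torus_proj_cases: obtains x where "a = torus_proj x"
  using that by (induction a rule: torus.abs_induct) blast

lemma closed_torus_fibre: "closed (torus_proj -` {a})"
proof -
  obtain y where a: "a = torus_proj y" by (rule torus_proj_cases)
  have "torus_proj -` {a} = {x. \<forall>i. x $ i - y $ i \<in> \<int>}"
    by (auto simp: a torus_proj_eq_iff)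
  moreover have "closed {x :: real^2. x $ i - y $ i \<in> \<int>}" for i
    using continuous_closed_vimage[OF closed_Ints, where f = "\<lambda>x :: real^2. x $ i - y $ i"]
    by (auto simp: vimage_def intro!: continuous_intros)
  ultimately show ?thesis by (simp add: closed_Collect_all)
qed

text \<open>The torus carries the metric induced by the Euclidean norm; \<open>open_torus_iff\<close> below shows that
  its topology is the quotient topology.\<close>

instantiation torus :: metric_space
begin

definition dist_torus :: "torus \<Rightarrow> torus \<Rightarrow> real" where
  "dist_torus a b = Inf {dist x y | x y. torus_proj x = a \<and> torus_proj y = b}"

definition uniformity_torus :: "(torus \<times> torus) filter" where
  "uniformity_torus = (INF e\<in>{0<..}. principal {(x, y). dist x y < e})"

definition open_torus :: "torus set \<Rightarrow> bool" where
  "open_torus U \<longleftrightarrow> (\<forall>x\<in>U. eventually (\<lambda>(x', y). x' = x \<longrightarrow> y \<in> U) uniformity)"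

lemma dist_torus_proj: "dist (torus_proj x) b = infdist x (torus_proj -` {b})"
proof -
  have ne: "torus_proj -` {b} \<noteq> {}" by (metis torus_proj_cases vimage_singleton_eq empty_iff)
  have "{dist x' y | x' y. torus_proj x' = torus_proj x \<and> torus_proj y = b}
      = dist x ` (torus_proj -` {b})" (is "?L = ?R")
  proof (intro equalityI subsetI)
    fix d assume "d \<in> ?L"
    then obtain x' y where d: "d = dist x' y" "torus_proj x' = torus_proj x" "torus_proj y = b"
      by blast
    have "torus_proj (y + (x - x')) = b"
      using d(2,3) by (auto simp: torus_proj_eq_iff) (metis Ints_minus minus_diff_eq)
    moreover have "d = dist x (y + (x - x'))"
      by (simp add: d(1) dist_norm algebra_simps)
    ultimately show "d \<in> ?R" by blast
  qed auto
  then show ?thesis using ne by (simp add: dist_torus_def infdist_def)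
qed

instance
proof
  show "uniformity = (INF e\<in>{0<..}. principal {(x :: torus, y). dist x y < e})"
    by (rule uniformity_torus_def)
  show "open U \<longleftrightarrow> (\<forall>x\<in>U. eventually (\<lambda>(x', y). x' = x \<longrightarrow> y \<in> U) uniformity)"
    for U :: "torus set" by (rule open_torus_def)
  show "dist a b = 0 \<longleftrightarrow> a = b" for a b :: torus
  proof -
    obtain x where a: "a = torus_proj x" by (rule torus_proj_cases)
    have ne: "torus_proj -` {b} \<noteq> {}" by (metis torus_proj_cases vimage_singleton_eq empty_iff)
    show ?thesis
      using in_closed_iff_infdist_zero[OF closed_torus_fibre ne, of x]
      by (auto simp: a dist_torus_proj)
  qed
  show "dist a b \<le> dist a c + dist b c" for a b c :: torus
  proof -
    have sym: "dist b c = dist c b" for b c :: torus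
      unfolding dist_torus_def by (rule arg_cong[where f = Inf]) (metis dist_commute)
    obtain x where a: "a = torus_proj x" by (rule torus_proj_cases)
    have nec: "torus_proj -` {c} \<noteq> {}" by (metis torus_proj_cases vimage_singleton_eq empty_iff)
    have *: "infdist x (torus_proj -` {b}) - dist c b \<le> dist x y" if "y \<in> torus_proj -` {c}" for y
      using that infdist_triangle[of x "torus_proj -` {b}" y] by (auto simp: dist_torus_proj)
    have "infdist x (torus_proj -` {b}) - dist c b \<le> infdist x (torus_proj -` {c})"
      unfolding infdist_notempty[OF nec] by (rule cINF_greatest[OF nec]) (rule *)
    then have "infdist x (torus_proj -` {b}) \<le> infdist x (torus_proj -` {c}) + dist c b"
      by linarith
    then show ?thesis unfolding a dist_torus_proj[symmetric] by (metis sym)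
  qed
qed

end

lemma dist_torus_proj_le: "dist (torus_proj x) (torus_proj y) \<le> dist x y"
  by (simp add: dist_torus_proj infdist_le)

lemma continuous_on_torus_proj: "continuous_on S torus_proj"
  unfolding continuous_on_iff by (metis dist_torus_proj_le order_le_less_trans)

lemma open_torus_iff: "open U \<longleftrightarrow> open (torus_proj -` U)"
proof
  assume "open U"
  then show "open (torus_proj -` U)"
    by (rule open_vimage) (rule continuous_on_torus_proj)
next
  assume *: "open (torus_proj -` U)"
  show "open U" unfolding open_dist
  proof
    fix a assume "a \<in> U"
    obtain x where a: "a = torus_proj x" by (rule torus_proj_cases)
    with * \<open>a \<in> U\<close> obtain e where e: "e > 0" "\<And>y. dist y x < e \<Longrightarrow> torus_proj y \<in> U"
      unfolding open_dist by auto
    have "b \<in> U" if "dist b a < e" for b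
    proof -
      have ne: "torus_proj -` {b} \<noteq> {}" by (metis torus_proj_cases vimage_singleton_eq empty_iff)
      have "infdist x (torus_proj -` {b}) < e"
        using that by (simp add: a dist_commute[of b] dist_torus_proj)
      then obtain y where "torus_proj y = b" "dist x y < e"
        unfolding infdist_notempty[OF ne] by (subst (asm) cINF_less_iff[OF ne]) auto
      then show ?thesis using e(2)[of y] by (auto simp: dist_commute)
    qed
    then show "\<exists>e>0. \<forall>b. dist b a < e \<longrightarrow> b \<in> U" using e(1) by blast
  qed
qed

definition torus_lborel :: "torus measure" where
  "torus_lborel =
     distr (restrict_space lborel {x :: real^2. \<forall>i. 0 \<le> x $ i \<and> x $ i < 1}) borel torus_proj"

lemma measurable_torus_proj [measurable]: "torus_proj \<in> borel \<rightarrow>\<^sub>M borel"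
  by (rule borel_measurable_continuous_onI) (rule continuous_on_torus_proj)

lemma emeasure_torus_lborel:
  assumes "A \<in> sets borel"
  shows "emeasure torus_lborel A =
    emeasure lborel (torus_proj -` A \<inter> {x. \<forall>i. 0 \<le> x $ i \<and> x $ i < 1})"
proof -
  let ?D = "{x :: real^2. \<forall>i. 0 \<le> x $ i \<and> x $ i < 1}"
  have D: "?D \<in> sets borel" by measurable
  have m: "torus_proj \<in> restrict_space lborel ?D \<rightarrow>\<^sub>M borel"
    by (intro measurable_restrict_space1) simp
  show ?thesis
    unfolding torus_lborel_def
    by (subst emeasure_distr[OF m assms], subst emeasure_restrict_space)
       (use D in \<open>auto simp: space_restrict_space\<close>)
qed


section \<open>Torus homeomorphisms\<close>

definition homeo0 :: "(torus \<Rightarrow> torus) \<Rightarrow> bool" where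
  "homeo0 f \<longleftrightarrow> (\<exists>g. homeomorphism UNIV UNIV f g) \<and>
     homotopic_with_canon (\<lambda>_. True) UNIV UNIV f id"

definition lift_of :: "(real^2 \<Rightarrow> real^2) \<Rightarrow> (torus \<Rightarrow> torus) \<Rightarrow> bool" where
  "lift_of F f \<longleftrightarrow> continuous_on UNIV F \<and> torus_proj \<circ> F = f \<circ> torus_proj"

definition rotation_set :: "(real^2 \<Rightarrow> real^2) \<Rightarrow> (real^2) set" where
  "rotation_set F = {\<rho>. \<exists>(n :: nat \<Rightarrow> nat) (z :: nat \<Rightarrow> real^2).
     mono n \<and> filterlim n at_top sequentially \<and>
     (\<lambda>i. ((F ^^ n i) (z i) - z i) /\<^sub>R real (n i)) \<longlonglongrightarrow> \<rho>}"

definition rotation_subset :: "torus set \<Rightarrow> (real^2 \<Rightarrow> real^2) \<Rightarrow> (real^2) set" where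
  "rotation_subset U F = {\<rho>. \<exists>(n :: nat \<Rightarrow> nat) (z :: nat \<Rightarrow> real^2).
     mono n \<and> filterlim n at_top sequentially \<and> (\<forall>i. z i \<in> torus_proj -` U) \<and>
     (\<lambda>i. ((F ^^ n i) (z i) - z i) /\<^sub>R real (n i)) \<longlonglongrightarrow> \<rho>}"

text \<open>The chaotic region of a map \<open>f\<close> homotopic to the identity, in terms of a lift \<open>F\<close> of \<open>f\<close>. Lifts
  of \<open>f\<close> differ by integer translations, which translate the rotation subsets, so the region
  depends on \<open>f\<close> only.\<close>

definition chaotic_region :: "(real^2 \<Rightarrow> real^2) \<Rightarrow> torus set" where
  "chaotic_region F =
     {z. \<forall>U. open U \<and> z \<in> U \<longrightarrow> interior (convex hull (rotation_subset U F)) \<noteq> {}}"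

definition torus_bounded :: "torus set \<Rightarrow> bool" where
  "torus_bounded U \<longleftrightarrow> (\<forall>C \<in> components (torus_proj -` U). bounded C)"

definition wandering_set :: "(torus \<Rightarrow> torus) \<Rightarrow> torus set \<Rightarrow> bool" where
  "wandering_set f U \<longleftrightarrow> (\<forall>n\<ge>1. (f ^^ n) ` U \<inter> U = {})"

definition wandering_point :: "(torus \<Rightarrow> torus) \<Rightarrow> torus \<Rightarrow> bool" where
  "wandering_point f z \<longleftrightarrow> (\<exists>U. open U \<and> z \<in> U \<and> wandering_set f U)"

definition nonwandering :: "(torus \<Rightarrow> torus) \<Rightarrow> bool" where
  "nonwandering f \<longleftrightarrow> (\<forall>z. \<not> wandering_point f z)"

definition area_preserving :: "(torus \<Rightarrow> torus) \<Rightarrow> bool" where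
  "area_preserving f \<longleftrightarrow>
     (\<forall>A \<in> sets borel. emeasure torus_lborel (f -` A) = emeasure torus_lborel A)"

definition lyapunov_stable :: "real \<Rightarrow> (torus \<Rightarrow> torus) \<Rightarrow> torus \<Rightarrow> bool" where
  "lyapunov_stable \<epsilon> f z \<longleftrightarrow>
     (\<exists>\<delta>>0. \<forall>n. (f ^^ n) ` ball z \<delta> \<subseteq> ball ((f ^^ n) z) \<epsilon>)"

end

theory Submission
  imports Defs
begin

text \<open>Suppose that the iterates of a small ball around a lift of \<open>z\<close> have diameter \<open>o(n)\<close>. Then all
  points of the ball have the same asymptotic velocities, so as soon as one coordinate of the velocity of
  one orbit converges, the rotation subset of the ball lies on a line and \<open>z\<close> is not chaotic.

  In (a), stability keeps the diameters below \<open>1\<close>. A return of the ball to an integer translate \<open>B + v\<close>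
  after \<open>n\<close> steps makes the orbit of the centre additive up to error \<open>1\<close> along steps of length \<open>n\<close>. Such
  \<open>n\<close> are arbitrarily large for a non-wandering map, hence the velocity converges. In (b), Birkhoff's
  theorem, applied to a coordinate of the displacement, provides the convergent orbit.\<close>

section \<open>The projection and lifts\<close>

lemma torus_proj_add_int: "(\<And>i. v $ i \<in> \<int>) \<Longrightarrow> torus_proj (x + v) = torus_proj x"
  by (simp add: torus_proj_eq_iff)

lemma continuous_on_torus_iff:
  "continuous_on UNIV g \<longleftrightarrow> continuous_on UNIV (g \<circ> torus_proj)"
  by (simp add: continuous_on_open_vimage open_torus_iff vimage_def)

text \<open>The saturation of \<open>S\<close> is the union of its integer translates, and each of
  these is open.\<close>

lemma open_torus_proj_image:
  assumes "open S" shows "open (torus_proj ` S)"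
proof -
  have "torus_proj -` (torus_proj ` S) = (\<Union>v \<in> {v. \<forall>i. v $ i \<in> \<int>}. (+) v ` S)" (is "?L = ?R")
  proof (intro equalityI subsetI)
    fix x assume "x \<in> ?L"
    then obtain s where "s \<in> S" "torus_proj x = torus_proj s" by auto
    then have "\<forall>i. (x - s) $ i \<in> \<int>" by (simp add: torus_proj_eq_iff)
    moreover have "x = (x - s) + s" by simp
    ultimately show "x \<in> ?R" using \<open>s \<in> S\<close> by blast
  next
    fix x assume "x \<in> ?R"
    then show "x \<in> ?L" using torus_proj_add_int by (auto simp: add.commute)
  qed
  then show ?thesis
    using assms by (simp add: open_torus_iff open_UN open_translation)
qed

section \<open>Circle-valued functions and their real lifts\<close>

lemma cis_two_pi_eq_iff: "cis (2 * pi * s) = cis (2 * pi * t) \<longleftrightarrow> s - t \<in> \<int>"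
proof -
  have "cis (2 * pi * s) = cis (2 * pi * t) \<longleftrightarrow> cis (2 * pi * (s - t)) = 1"
    by (simp add: right_diff_distrib cis_divide[symmetric])
  also have "\<dots> \<longleftrightarrow> (\<exists>n::int. s - t = of_int n)"
  proof -
    have "2 * pi * (s - t) = of_int (2 * n) * pi \<longleftrightarrow> s - t = of_int n" for n :: int
      by simp
    then show ?thesis by (simp add: cis_conv_exp exp_eq_1)
  qed
  finally show ?thesis by (auto simp: Ints_def)
qed

text \<open>A function without zeros on a contractible set has a continuous logarithm
  \<open>h\<close>. Modulus 1 makes \<open>h\<close> purely imaginary, so its imaginary part divided
  by \<open>2 * pi\<close> is the required real lift.\<close>

lemma circle_lift_on_contractible:
  fixes k :: "'a::real_normed_vector \<Rightarrow> complex"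
  assumes "continuous_on S k" "contractible S" "\<And>x. x \<in> S \<Longrightarrow> norm (k x) = 1"
  obtains g :: "'a \<Rightarrow> real" where "continuous_on S g" "\<And>x. x \<in> S \<Longrightarrow> k x = cis (2 * pi * g x)"
proof -
  obtain h where h: "continuous_on S h" "\<And>x. x \<in> S \<Longrightarrow> k x = exp (h x)"
  proof (rule continuous_logarithm_on_contractible[OF assms(1,2)])
    show "k x \<noteq> 0" if "x \<in> S" for x using assms(3)[OF that] by auto
  qed blast
  show ?thesis
  proof
    show "continuous_on S (\<lambda>x. Im (h x) / (2 * pi))"
      using h(1) by (intro continuous_intros) auto
    fix x assume "x \<in> S"
    then have "norm (exp (h x)) = 1" using h(2) assms(3) by metis
    then have "Re (h x) = 0" by (simp add: norm_exp_eq_Re)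
    then have "exp (h x) = cis (Im (h x))" using exp_eq_polar[of "h x"] by simp
    with h(2) \<open>x \<in> S\<close> show "k x = cis (2 * pi * (Im (h x) / (2 * pi)))" by simp
  qed
qed

lemma continuous_Ints_constant:
  fixes g :: "'a::topological_space \<Rightarrow> real"
  assumes "connected S" "continuous_on S g" "\<And>x. x \<in> S \<Longrightarrow> g x \<in> \<int>" "x \<in> S" "y \<in> S"
  shows "g x = g y"
proof -
  have "g constant_on S"
  proof (rule continuous_discrete_range_constant[OF assms(1,2)])
    fix x assume "x \<in> S"
    then have "1 \<le> norm (g y - g x)" if "y \<in> S" "g y \<noteq> g x" for y
      using that assms(3) Ints_nonzero_abs_ge1[of "g y - g x"] by simp
    then show "\<exists>e>0. \<forall>y. y \<in> S \<and> g y \<noteq> g x \<longrightarrow> e \<le> norm (g y - g x)"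
      by (intro exI[of _ 1]) auto
  qed
  with assms(4,5) show ?thesis by (auto simp: constant_on_def)
qed

text \<open>The \<open>i\<close>-th circle coordinate, with the torus seen as a product of two
  circles. The chosen representative does not affect the value, since
  \<open>cis (2 * pi * t)\<close> has period 1 in \<open>t\<close>.\<close>

definition torus_circle :: "2 \<Rightarrow> torus \<Rightarrow> complex" where
  "torus_circle i a = cis (2 * pi * torus_rep a $ i)"

lemma torus_circle_proj: "torus_circle i (torus_proj x) = cis (2 * pi * x $ i)"
proof -
  have "torus_proj (torus_rep (torus_proj x)) = torus_proj x"
    by (rule Quotient3_abs_rep[OF Quotient3_torus])
  then show ?thesis
    by (simp add: torus_circle_def cis_two_pi_eq_iff torus_proj_eq_iff)
qed

lemma continuous_on_torus_circle: "continuous_on UNIV (torus_circle i)"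
  unfolding continuous_on_torus_iff
  by (simp add: comp_def torus_circle_proj) (intro continuous_intros)

text \<open>A homotopy from \<open>f\<close> to the identity lifts coordinatewise; the displacement of an integer
  translate is an integer depending continuously on time, hence it is the same for \<open>F\<close> and for the
  identity.\<close>

lemma lift_add_int:
  assumes "homeo0 f" "lift_of F f" and v: "\<And>i. v $ i \<in> \<int>"
  shows "F (x + v) = F x + v"
proof -
  obtain H where "continuous_map (prod_topology (top_of_set {0..1::real}) euclidean) euclidean H"
    and H0: "\<forall>a. H (0, a) = f a" and H1: "\<forall>a. H (1, a) = a"
    using assms(1) by (auto simp: homeo0_def homotopic_with_def)
  then have H: "continuous_on ({0..1} \<times> UNIV) H"
    by (simp add: continuous_map_subtopology_eu
        prod_topology_subtopology_eu[of "{0..1::real}" "UNIV::torus set", simplified])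
  have F: "continuous_on UNIV F" "\<And>x. torus_proj (F x) = f (torus_proj x)"
    using assms(2) by (auto simp: lift_of_def fun_eq_iff)
  have "F (x + v) $ i = F x $ i + v $ i" for i
  proof -
    let ?S = "{0..1::real} \<times> (UNIV :: (real^2) set)"
    \<comment> \<open>The circle coordinate of the homotopy, pulled back to the plane at every time.
      Its domain is convex, so \<open>?k\<close> has a real lift \<open>g\<close>.\<close>
    let ?k = "\<lambda>p. torus_circle i (H (fst p, torus_proj (snd p)))"
    have "continuous_on ?S ?k"
      by (intro continuous_on_compose2[OF continuous_on_torus_circle]
          continuous_on_compose2[OF H] continuous_on_compose2[OF continuous_on_torus_proj]
          continuous_intros) auto
    moreover have "convex ?S" by (intro convex_Times) auto
    ultimately obtain g where g: "continuous_on ?S g" "\<And>p. p \<in> ?S \<Longrightarrow> ?k p = cis (2 * pi * g p)"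
      by (rule circle_lift_on_contractible[OF _ convex_imp_contractible])
        (auto simp: torus_circle_def)
    have conn: "connected ?S" using \<open>convex ?S\<close> by (rule convex_connected)
    have cg: "continuous_on UNIV (\<lambda>x. g (t, x))" if "t \<in> {0..1}" for t
      using that by (intro continuous_on_compose2[OF g(1)] continuous_intros) auto
    have shift: "g (0, x + v) - g (0, x) = g (1, x + v) - g (1, x)"
    proof -
      let ?d = "\<lambda>p. g (fst p, snd p + v) - g p"
      have "?d p \<in> \<int>" if "p \<in> ?S" for p
      proof -
        have "(fst p, snd p + v) \<in> ?S" using that by auto
        from g(2)[OF this] g(2)[OF that]
        have "cis (2 * pi * g (fst p, snd p + v)) = cis (2 * pi * g p)"
          by (simp add: torus_proj_add_int v)
        then show ?thesis by (simp add: cis_two_pi_eq_iff)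
      qed
      moreover have "continuous_on ?S ?d"
        by (intro continuous_intros continuous_on_compose2[OF g(1)] g(1)) auto
      ultimately have "?d (0, x) = ?d (1, x)"
        by (intro continuous_Ints_constant[OF conn]) auto
      then show ?thesis by simp
    qed
    \<comment> \<open>The homotopy ends at the identity, so \<open>g (1, x)\<close> and
      \<open>x $ i\<close> lift the same circle value and differ by a constant integer. At time 0
      the same holds for \<open>F x $ i\<close>.\<close>
    have "g (1, x + v) - (x + v) $ i = g (1, x) - x $ i"
    proof (rule continuous_Ints_constant[OF connected_UNIV, where g = "\<lambda>x. g (1, x) - x $ i"])
      show "continuous_on UNIV (\<lambda>x. g (1, x) - x $ i)" by (intro continuous_intros cg) auto
      show "g (1, x) - x $ i \<in> \<int>" for x
        using g(2)[of "(1, x)"] by (simp add: H1 torus_circle_proj cis_two_pi_eq_iff[symmetric])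
    qed auto
    moreover have "F (x + v) $ i - g (0, x + v) = F x $ i - g (0, x)"
    proof (rule continuous_Ints_constant[OF connected_UNIV, where g = "\<lambda>x. F x $ i - g (0, x)"])
      show "continuous_on UNIV (\<lambda>x. F x $ i - g (0, x))"
        by (intro continuous_intros cg F(1)) auto
      show "F x $ i - g (0, x) \<in> \<int>" for x
        using g(2)[of "(0, x)"] torus_circle_proj[of i "F x"]
        by (simp add: H0 F(2) cis_two_pi_eq_iff[symmetric])
    qed auto
    ultimately show ?thesis using shift by simp
  qed
  then show ?thesis by (simp add: vec_eq_iff)
qed

section \<open>Iterates of lifts\<close>

lemma lift_funpow_add_int:
  assumes "\<And>x v. (\<And>i. v $ i \<in> \<int>) \<Longrightarrow> F (x + v) = F x + v" "\<And>i. v $ i \<in> \<int>"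
  shows "(F ^^ n) (x + v) = (F ^^ n) x + v"
  by (induction n) (use assms in auto)

lemma continuous_on_funpow:
  fixes g :: "'a::topological_space \<Rightarrow> 'a"
  shows "continuous_on UNIV g \<Longrightarrow> continuous_on UNIV (g ^^ n)"
proof (induction n)
  case (Suc n)
  then have "continuous_on UNIV (g \<circ> (g ^^ n))"
    by (intro continuous_on_compose) (auto intro: continuous_on_subset)
  then show ?case by simp
qed simp

lemma lift_of_funpow:
  assumes "lift_of F f" shows "lift_of (F ^^ n) (f ^^ n)"
proof -
  have "torus_proj ((F ^^ n) x) = (f ^^ n) (torus_proj x)" for x
    by (induction n) (use assms in \<open>auto simp: lift_of_def fun_eq_iff\<close>)
  then show ?thesis
    using assms continuous_on_funpow by (auto simp: lift_of_def)
qed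

lemma lift_of_proj: "lift_of F f \<Longrightarrow> torus_proj (F x) = f (torus_proj x)"
  by (simp add: lift_of_def fun_eq_iff)

section \<open>A criterion for non-chaotic points\<close>

text \<open>The orbits of the ball separate by at most \<open>d n\<close>, so the
  \<open>i\<close>-th velocity of every point over the ball has the limit \<open>l\<close> found for
  \<open>y\<close>, uniformly. The rotation subset then lies in a line, which is convex and has
  empty interior.\<close>

lemma not_chaotic_if_sublinear:
  assumes F: "\<And>x v. (\<And>i. v $ i \<in> \<int>) \<Longrightarrow> F (x + v) = F x + v"
    and "r > 0" "y \<in> ball x r"
    and d: "\<And>n y z. y \<in> ball x r \<Longrightarrow> z \<in> ball x r \<Longrightarrow> dist ((F ^^ n) y) ((F ^^ n) z) \<le> d n"
    and d0: "(\<lambda>n. d n / real n) \<longlonglongrightarrow> 0"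
    and l: "(\<lambda>n. ((F ^^ n) y - y) $ i / real n) \<longlonglongrightarrow> l"
  shows "torus_proj x \<notin> chaotic_region F"
proof
  assume chaotic: "torus_proj x \<in> chaotic_region F"
  let ?U = "torus_proj ` ball x r"
  have "open ?U" by (intro open_torus_proj_image open_ball)
  with chaotic \<open>r > 0\<close> have ne: "interior (convex hull (rotation_subset ?U F)) \<noteq> {}"
    by (auto simp: chaotic_region_def)
  \<comment> \<open>The error has two sources: \<open>d n\<close> bounds the distance of the
    endpoints, \<open>2 * r\<close> that of the starting points.\<close>
  define e where "e n = d n / real n + 2 * r / real n" for n
  have "(\<lambda>n. e n) \<longlonglongrightarrow> 0 + 0"
    unfolding e_def by (intro tendsto_add d0 lim_const_over_n)
  then have e0: "e \<longlonglongrightarrow> 0" by simp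
  have bound: "\<bar>((F ^^ n) z - z) $ i / real n - ((F ^^ n) y - y) $ i / real n\<bar> \<le> e n"
    if z: "z \<in> torus_proj -` ?U" for z n
  proof -
    from z obtain w where w: "w \<in> ball x r" "torus_proj z = torus_proj w" by auto
    then have v: "\<And>i. (z - w) $ i \<in> \<int>" by (simp add: torus_proj_eq_iff)
    \<comment> \<open>Displacements are invariant under integer translations, so \<open>z\<close>
      may be replaced by its representative \<open>w\<close> in the ball.\<close>
    from lift_funpow_add_int[OF F this, where x = w] have "(F ^^ n) z - z = (F ^^ n) w - w" by simp
    then have "((F ^^ n) z - z) - ((F ^^ n) y - y) = ((F ^^ n) w - (F ^^ n) y) + (y - w)" by simp
    then have "norm (((F ^^ n) z - z) - ((F ^^ n) y - y))
        \<le> dist ((F ^^ n) w) ((F ^^ n) y) + dist y w"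
      by (metis dist_norm norm_triangle_ineq)
    also have "dist ((F ^^ n) w) ((F ^^ n) y) \<le> d n" using d w(1) \<open>y \<in> ball x r\<close> by blast
    also have "dist y w \<le> 2 * r"
      using w(1) \<open>y \<in> ball x r\<close> dist_triangle[of y w x] by (simp add: dist_commute)
    finally have "\<bar>(((F ^^ n) z - z) - ((F ^^ n) y - y)) $ i\<bar> \<le> d n + 2 * r"
      using component_le_norm_cart order_trans by fastforce
    then have "\<bar>(((F ^^ n) z - z) - ((F ^^ n) y - y)) $ i\<bar> / real n \<le> (d n + 2 * r) / real n"
      by (rule divide_right_mono) simp
    then show ?thesis
      by (simp add: e_def add_divide_distrib flip: diff_divide_distrib)
  qed
  have "rotation_subset ?U F \<subseteq> {\<rho>. axis i 1 \<bullet> \<rho> = l}"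
  proof
    fix \<rho> assume "\<rho> \<in> rotation_subset ?U F"
    then obtain n z where n: "filterlim n at_top sequentially"
      and z: "\<forall>j. z j \<in> torus_proj -` ?U"
      and lim: "(\<lambda>j. ((F ^^ n j) (z j) - z j) /\<^sub>R real (n j)) \<longlonglongrightarrow> \<rho>"
      by (auto simp: rotation_subset_def)
    have "(\<lambda>j. (((F ^^ n j) (z j) - z j) /\<^sub>R real (n j)) $ i) \<longlonglongrightarrow> \<rho> $ i"
      by (intro tendsto_intros lim)
    then have 1: "(\<lambda>j. ((F ^^ n j) (z j) - z j) $ i / real (n j)) \<longlonglongrightarrow> \<rho> $ i"
      by (simp add: divide_inverse mult.commute)
    \<comment> \<open>The starting points \<open>z j\<close> vary with \<open>j\<close>, but
      \<open>y\<close> is fixed, so its limit passes to the times \<open>n j\<close>.\<close>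
    have 2: "(\<lambda>j. ((F ^^ n j) y - y) $ i / real (n j)) \<longlonglongrightarrow> l"
      by (rule filterlim_compose[OF l n])
    have "(\<lambda>j. ((F ^^ n j) (z j) - z j) $ i / real (n j) - ((F ^^ n j) y - y) $ i / real (n j))
        \<longlonglongrightarrow> 0"
    proof (rule tendsto_rabs_zero_cancel, rule tendsto_sandwich[OF _ _ tendsto_const])
      show "(\<lambda>j. e (n j)) \<longlonglongrightarrow> 0" by (rule filterlim_compose[OF e0 n])
      show "\<forall>\<^sub>F j in sequentially. \<bar>((F ^^ n j) (z j) - z j) $ i / real (n j)
          - ((F ^^ n j) y - y) $ i / real (n j)\<bar> \<le> e (n j)"
        by (intro always_eventually allI bound) (use z in blast)
    qed (intro always_eventually allI abs_ge_zero)
    from LIMSEQ_unique[OF tendsto_diff[OF 1 2] this] have "\<rho> $ i - l = 0" .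
    then show "\<rho> \<in> {\<rho>. axis i 1 \<bullet> \<rho> = l}" by (simp add: inner_axis')
  qed
  then have "convex hull (rotation_subset ?U F) \<subseteq> {\<rho>. axis i 1 \<bullet> \<rho> = l}"
    by (intro hull_minimal convex_hyperplane)
  then have "interior (convex hull (rotation_subset ?U F)) \<subseteq> interior {\<rho>. axis i 1 \<bullet> \<rho> = l}"
    by (rule interior_mono)
  also have "\<dots> = {}" by (intro interior_hyperplane) (simp add: axis_eq_0_iff)
  finally show False using ne by simp
qed

section \<open>Birkhoff's ergodic theorem for bounded functions\<close>

text \<open>The maximum of the Birkhoff sums of all lengths from 0 to \<open>n\<close>, where the
  empty sum contributes 0. The recursion splits off the first step, which relates the value at
  \<open>x\<close> directly to that at \<open>T x\<close>.\<close>

primrec max_birkhoff_sum :: "('a \<Rightarrow> 'a) \<Rightarrow> ('a \<Rightarrow> real) \<Rightarrow> nat \<Rightarrow> 'a \<Rightarrow> real" where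
  "max_birkhoff_sum T \<phi> 0 x = 0"
| "max_birkhoff_sum T \<phi> (Suc n) x = max 0 (\<phi> x + max_birkhoff_sum T \<phi> n (T x))"

lemma birkhoff_sum_Suc:
  "(\<Sum>k<Suc n. \<phi> ((T ^^ k) x)) = \<phi> x + (\<Sum>k<n. \<phi> ((T ^^ k) (T x)))" for \<phi> :: "'a \<Rightarrow> real"
  by (simp only: sum.lessThan_Suc_shift funpow_simps_right comp_apply) simp

lemma birkhoff_sum_le_max: "(\<Sum>k<n. \<phi> ((T ^^ k) x)) \<le> max_birkhoff_sum T \<phi> n x"
proof (induction n arbitrary: x)
  case (Suc n)
  show ?case using Suc[of "T x"] unfolding birkhoff_sum_Suc by simp
qed simp

lemma max_birkhoff_sum_nonneg: "0 \<le> max_birkhoff_sum T \<phi> n x"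
  by (cases n) auto

lemma max_birkhoff_sum_mono: "m \<le> n \<Longrightarrow> max_birkhoff_sum T \<phi> m x \<le> max_birkhoff_sum T \<phi> n x"
proof (induction m arbitrary: n x)
  case (Suc m)
  then obtain k where "n = Suc k" "m \<le> k" by (cases n) auto
  with Suc.IH[of k "T x"] show ?case by simp
qed (simp add: max_birkhoff_sum_nonneg)

section \<open>The maximal ergodic theorem\<close>

lemma integral_measure_preserving:
  fixes g :: "'a \<Rightarrow> real"
  assumes T: "T \<in> M \<rightarrow>\<^sub>M M" "distr M M T = M" and g: "integrable M g"
  shows "integrable M (\<lambda>x. g (T x))" "(\<integral>x. g (T x) \<partial>M) = (\<integral>x. g x \<partial>M)"
proof -
  have m: "g \<in> borel_measurable M" using g by auto
  show "integrable M (\<lambda>x. g (T x))"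
    using g integrable_distr_eq[OF T(1) m] T(2) by simp
  show "(\<integral>x. g (T x) \<partial>M) = (\<integral>x. g x \<partial>M)"
    using integral_distr[OF T(1) m] T(2) by simp
qed

text \<open>Garsia's argument. Where \<open>?m (Suc n)\<close> is positive, it equals
  \<open>\<phi> x + ?m n (T x)\<close> and thus exceeds \<open>?m (Suc n) (T x)\<close> by at most
  \<open>\<phi> x\<close>; elsewhere it is 0 and exceeds nothing. The positivity hypothesis concerns
  only points with \<open>\<phi> x \<noteq> 0\<close>, so that \<open>\<phi>\<close> may be cut off
  outside an invariant set.\<close>

lemma maximal_ergodic:
  fixes \<phi> :: "'a \<Rightarrow> real"
  assumes T: "T \<in> M \<rightarrow>\<^sub>M M" "distr M M T = M" and \<phi>: "integrable M \<phi>"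
    and pos: "\<And>x. x \<in> space M \<Longrightarrow> \<phi> x \<noteq> 0 \<Longrightarrow> \<exists>n. 0 < (\<Sum>k<n. \<phi> ((T ^^ k) x))"
  shows "0 \<le> (\<integral>x. \<phi> x \<partial>M)"
proof -
  let ?m = "max_birkhoff_sum T \<phi>"
  have int: "integrable M (?m n)" for n
  proof (induction n)
    case (Suc n)
    show ?case
      using integral_measure_preserving(1)[OF T Suc] \<phi> by simp
  qed simp
  let ?g = "\<lambda>n x. \<phi> x * indicator {x \<in> space M. 0 < ?m (Suc n) x} x"
  have sets: "{x \<in> space M. 0 < ?m n x} \<in> sets M" for n
    using borel_measurable_integrable[OF int[of n]] by measurable
  have g_int: "integrable M (?g n)" for n
    by (rule integrable_real_mult_indicator[OF sets \<phi>])
  have g_nonneg: "0 \<le> (\<integral>x. ?g n x \<partial>M)" for n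
  proof -
    \<comment> \<open>Invariance of the measure gives both terms the same integral.\<close>
    have "0 = (\<integral>x. ?m (Suc n) x - ?m (Suc n) (T x) \<partial>M)"
      using integral_measure_preserving[OF T int[of "Suc n"]] int[of "Suc n"]
      by (simp del: max_birkhoff_sum.simps)
    also have "\<dots> \<le> (\<integral>x. ?g n x \<partial>M)"
    proof (rule integral_mono[OF _ g_int])
      show "integrable M (\<lambda>x. ?m (Suc n) x - ?m (Suc n) (T x))"
        using integral_measure_preserving(1)[OF T int[of "Suc n"]] int[of "Suc n"]
        by (rule Bochner_Integration.integrable_diff[rotated])
      fix x assume "x \<in> space M"
      have "0 \<le> ?m (Suc n) (T x)" by (rule max_birkhoff_sum_nonneg)
      moreover have "?m n (T x) \<le> ?m (Suc n) (T x)" by (rule max_birkhoff_sum_mono) simp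
      moreover have "?m (Suc n) x = max 0 (\<phi> x + ?m n (T x))" by simp
      ultimately show "?m (Suc n) x - ?m (Suc n) (T x) \<le> ?g n x"
        using \<open>x \<in> space M\<close> by (auto simp: indicator_def simp del: max_birkhoff_sum.simps)
    qed
    finally show ?thesis .
  qed
  \<comment> \<open>The sets where \<open>?m (Suc n)\<close> is positive increase and eventually
    contain every point with \<open>\<phi> x \<noteq> 0\<close>.\<close>
  have "(\<lambda>n. \<integral>x. ?g n x \<partial>M) \<longlonglongrightarrow> (\<integral>x. \<phi> x \<partial>M)"
  proof (rule integral_dominated_convergence[where w = "\<lambda>x. \<bar>\<phi> x\<bar>"])
    show "AE x in M. (\<lambda>n. ?g n x) \<longlonglongrightarrow> \<phi> x"
    proof (rule AE_I2)
      fix x assume x: "x \<in> space M"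
      show "(\<lambda>n. ?g n x) \<longlonglongrightarrow> \<phi> x"
      proof (cases "\<phi> x = 0")
        case False
        then obtain N where "0 < (\<Sum>k<N. \<phi> ((T ^^ k) x))" using pos x by blast
        then have "0 < ?m N x" by (rule order_less_le_trans[OF _ birkhoff_sum_le_max])
        then have "0 < ?m (Suc n) x" if "n \<ge> N" for n
          using max_birkhoff_sum_mono[of N "Suc n" T \<phi> x] that by linarith
        then have "?g n x = \<phi> x" if "n \<ge> N" for n using that x by simp
        then show ?thesis
          by (intro tendsto_eventually) (auto simp: eventually_sequentially)
      qed simp
    qed
  qed (use \<phi> sets g_int in \<open>auto simp: indicator_def\<close>)
  then show ?thesis by (rule LIMSEQ_le_const) (use g_nonneg in auto)
qed

text \<open>Orbits that start in \<open>E\<close> stay there, so multiplying by the indicator of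
  \<open>E\<close> leaves their Birkhoff sums unchanged; outside \<open>E\<close> the product
  vanishes.\<close>

lemma maximal_ergodic_invariant:
  fixes \<phi> :: "'a \<Rightarrow> real"
  assumes T: "T \<in> M \<rightarrow>\<^sub>M M" "distr M M T = M" and \<phi>: "integrable M \<phi>"
    and E: "E \<in> sets M" "\<And>x. x \<in> E \<Longrightarrow> T x \<in> E"
    and pos: "\<And>x. x \<in> E \<Longrightarrow> \<exists>n. 0 < (\<Sum>k<n. \<phi> ((T ^^ k) x))"
  shows "0 \<le> (\<integral>x. \<phi> x * indicator E x \<partial>M)"
proof (rule maximal_ergodic[OF T])
  show "integrable M (\<lambda>x. \<phi> x * indicator E x)"
    by (rule integrable_real_mult_indicator[OF E(1) \<phi>])
  fix x assume "\<phi> x * indicator E x \<noteq> 0"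
  then have x: "x \<in> E" by (auto simp: indicator_def split: if_splits)
  have "(T ^^ k) x \<in> E" for k by (induction k) (use x E(2) in auto)
  then show "\<exists>n. 0 < (\<Sum>k<n. \<phi> ((T ^^ k) x) * indicator E ((T ^^ k) x))"
    using pos[OF x] by simp
qed

section \<open>Almost everywhere convergence of time averages\<close>

definition birkhoff_average :: "('a \<Rightarrow> 'a) \<Rightarrow> ('a \<Rightarrow> real) \<Rightarrow> nat \<Rightarrow> 'a \<Rightarrow> real" where
  "birkhoff_average T \<phi> n x = (\<Sum>k<n. \<phi> ((T ^^ k) x)) / real n"

text \<open>The sums along the orbits of \<open>x\<close> and \<open>T x\<close> differ only in
  their first and last terms. This makes sets defined by the limsup and liminf of the averages
  invariant.\<close>

lemma birkhoff_average_shift: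
  assumes T: "T \<in> space M \<rightarrow> space M" and \<phi>: "\<And>x. x \<in> space M \<Longrightarrow> \<bar>\<phi> x\<bar> \<le> K"
    and x: "x \<in> space M"
  shows "(\<lambda>n. birkhoff_average T \<phi> n (T x) - birkhoff_average T \<phi> n x) \<longlonglongrightarrow> 0"
proof (rule tendsto_rabs_zero_cancel, rule tendsto_sandwich[OF _ _ tendsto_const])
  have orbit: "(T ^^ k) x \<in> space M" for k by (induction k) (use T x in auto)
  have "\<bar>birkhoff_average T \<phi> n (T x) - birkhoff_average T \<phi> n x\<bar> \<le> 2 * K / real n" for n
  proof -
    have "(\<Sum>k<n. \<phi> ((T ^^ k) (T x))) - (\<Sum>k<n. \<phi> ((T ^^ k) x)) = \<phi> ((T ^^ n) x) - \<phi> x"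
      using birkhoff_sum_Suc[of \<phi> T x n] by simp
    moreover have "\<bar>\<phi> ((T ^^ n) x) - \<phi> x\<bar> \<le> 2 * K"
      using \<phi>[OF orbit, of n] \<phi>[OF x] by linarith
    ultimately show ?thesis
      by (simp add: birkhoff_average_def divide_right_mono flip: diff_divide_distrib)
  qed
  then show "\<forall>\<^sub>F n in sequentially.
      \<bar>birkhoff_average T \<phi> n (T x) - birkhoff_average T \<phi> n x\<bar> \<le> 2 * K / real n"
    by simp
  show "(\<lambda>n. 2 * K / real n) \<longlonglongrightarrow> 0" by (rule lim_const_over_n)
qed simp

lemma limsup_liminf_eq_if_diff_tendsto_0:
  fixes u v :: "nat \<Rightarrow> real"
  assumes "(\<lambda>n. u n - v n) \<longlonglongrightarrow> 0"
  shows "limsup u = limsup v" "liminf u = liminf v"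
proof -
  have "(\<lambda>n. ereal (u n - v n)) \<longlonglongrightarrow> 0"
    using assms by (simp add: zero_ereal_def)
  from ereal_limsup_lim_add[OF this, of v] ereal_liminf_lim_add[OF this, of v]
  show "limsup u = limsup v" "liminf u = liminf v" by simp_all
qed

text \<open>For \<open>a < b\<close>, let \<open>E\<close> be the invariant set where the averages
  have liminf below \<open>a\<close> and limsup above \<open>b\<close>. The maximal inequality on
  \<open>E\<close> for \<open>\<phi> - b\<close> and for \<open>a - \<phi>\<close> yields that
  \<open>(a - b)\<close> times the measure of \<open>E\<close> is nonnegative, so \<open>E\<close>
  is null. Countably many rational pairs exhaust the oscillation.\<close>

theorem birkhoff_bounded:
  fixes \<phi> :: "'a \<Rightarrow> real"
  assumes "finite_measure M" and T: "T \<in> M \<rightarrow>\<^sub>M M" "distr M M T = M"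
    and \<phi>: "\<phi> \<in> borel_measurable M" and K: "\<And>x. x \<in> space M \<Longrightarrow> \<bar>\<phi> x\<bar> \<le> K"
  shows "AE x in M. convergent (\<lambda>n. birkhoff_average T \<phi> n x)"
proof -
  interpret finite_measure M by fact
  let ?A = "birkhoff_average T \<phi>"
  have TM: "T \<in> space M \<rightarrow> space M" using T(1) by (auto dest: measurable_space)
  have [measurable]: "T ^^ k \<in> M \<rightarrow>\<^sub>M M" for k
    by (induction k) (use T(1) in auto)
  note \<phi>[measurable]
  have [measurable]: "?A n \<in> borel_measurable M" for n
    unfolding birkhoff_average_def[abs_def] by measurable
  have int: "integrable M \<phi>"
    by (rule integrable_const_bound[where B = K]) (use K in auto)
  have null: "AE x in M. \<not> (liminf (\<lambda>n. ?A n x) < ereal a \<and> ereal b < limsup (\<lambda>n. ?A n x))"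
    if "a < b" for a b
  proof -
    define E where
      "E = {x \<in> space M. liminf (\<lambda>n. ?A n x) < ereal a \<and> ereal b < limsup (\<lambda>n. ?A n x)}"
    have E: "E \<in> sets M" unfolding E_def by measurable
    have inv: "T x \<in> E" if "x \<in> E" for x
    proof -
      have "x \<in> space M" using that by (simp add: E_def)
      from limsup_liminf_eq_if_diff_tendsto_0[OF birkhoff_average_shift[OF TM K this]] that
      show ?thesis using TM by (auto simp: E_def)
    qed
    have "0 \<le> (\<integral>x. (\<phi> x - b) * indicator E x \<partial>M)"
    proof (rule maximal_ergodic_invariant[OF T _ E inv])
      fix x assume "x \<in> E"
      \<comment> \<open>The bound \<open>n \<ge> 1\<close> matters: the average of length 0 has
        value 0 by division by zero, which may exceed \<open>b\<close> although the empty sum is not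
        positive.\<close>
      have "\<exists>n\<ge>1. b < ?A n x"
      proof (rule ccontr)
        assume "\<not> ?thesis"
        then have "\<forall>\<^sub>F n in sequentially. ereal (?A n x) \<le> ereal b"
          by (auto simp: eventually_sequentially not_less)
        then have "limsup (\<lambda>n. ?A n x) \<le> ereal b" by (rule Limsup_bounded)
        with \<open>x \<in> E\<close> show False by (auto simp: E_def)
      qed
      then obtain n where "n \<ge> 1" "b < ?A n x" by blast
      then have "0 < (\<Sum>k<n. \<phi> ((T ^^ k) x) - b)"
        by (simp add: birkhoff_average_def sum_subtractf field_simps)
      then show "\<exists>n. 0 < (\<Sum>k<n. \<phi> ((T ^^ k) x) - b)" by blast
    qed (use int in auto)
    moreover have "0 \<le> (\<integral>x. (a - \<phi> x) * indicator E x \<partial>M)"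
    proof (rule maximal_ergodic_invariant[OF T _ E inv])
      fix x assume "x \<in> E"
      have "\<exists>n\<ge>1. ?A n x < a"
      proof (rule ccontr)
        assume "\<not> ?thesis"
        then have "\<forall>\<^sub>F n in sequentially. ereal a \<le> ereal (?A n x)"
          by (auto simp: eventually_sequentially not_less)
        then have "ereal a \<le> liminf (\<lambda>n. ?A n x)" by (rule Liminf_bounded)
        with \<open>x \<in> E\<close> show False by (auto simp: E_def)
      qed
      then obtain n where "n \<ge> 1" "?A n x < a" by blast
      then have "0 < (\<Sum>k<n. a - \<phi> ((T ^^ k) x))"
        by (simp add: birkhoff_average_def sum_subtractf field_simps)
      then show "\<exists>n. 0 < (\<Sum>k<n. a - \<phi> ((T ^^ k) x))" by blast
    qed (use int in auto)
    ultimately have "0 \<le> (\<integral>x. (\<phi> x - b) * indicator E x \<partial>M) + (\<integral>x. (a - \<phi> x) * indicator E x \<partial>M)"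
      by simp
    also have "\<dots> = (\<integral>x. (\<phi> x - b) * indicator E x + (a - \<phi> x) * indicator E x \<partial>M)"
      using int E
      by (intro Bochner_Integration.integral_add[symmetric] integrable_real_mult_indicator) auto
    also have "\<dots> = (\<integral>x. (a - b) * indicator E x \<partial>M)"
      by (intro Bochner_Integration.integral_cong) (auto simp: algebra_simps)
    also have "\<dots> = (a - b) * measure M E" using E by simp
    finally have "measure M E = 0"
      using \<open>a < b\<close> measure_nonneg[of M E] by (simp add: zero_le_mult_iff)
    then have "E \<in> null_sets M" using E by (simp add: null_sets_def emeasure_eq_measure)
    then have "AE x in M. x \<notin> E" by (rule AE_not_in)
    then show ?thesis by (auto simp: E_def elim: AE_mp)
  qed
  have "AE x in M. \<forall>p\<in>{(a :: rat, b). a < b}.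
      \<not> (liminf (\<lambda>n. ?A n x) < ereal (of_rat (fst p)) \<and> ereal (of_rat (snd p)) < limsup (\<lambda>n. ?A n x))"
  proof (subst AE_ball_countable)
    show "countable {(a :: rat, b). a < b}" by (rule countableI_type)
    show "\<forall>p\<in>{(a :: rat, b). a < b}. AE x in M. \<not> (liminf (\<lambda>n. ?A n x) < ereal (of_rat (fst p)) \<and>
        ereal (of_rat (snd p)) < limsup (\<lambda>n. ?A n x))"
      by (intro ballI null) (auto simp: of_rat_less)
  qed
  then show ?thesis
  proof (rule AE_mp, intro AE_I2 impI)
    fix x assume x: "x \<in> space M" and *: "\<forall>p\<in>{(a :: rat, b). a < b}.
      \<not> (liminf (\<lambda>n. ?A n x) < ereal (of_rat (fst p)) \<and> ereal (of_rat (snd p)) < limsup (\<lambda>n. ?A n x))"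
    have orbit: "(T ^^ k) x \<in> space M" for k by (induction k) (use TM x in auto)
    have "\<not> liminf (\<lambda>n. ?A n x) < limsup (\<lambda>n. ?A n x)"
    proof
      assume "liminf (\<lambda>n. ?A n x) < limsup (\<lambda>n. ?A n x)"
      then obtain b :: rat where b: "liminf (\<lambda>n. ?A n x) < real_of_rat b"
          "real_of_rat b < limsup (\<lambda>n. ?A n x)"
        using ereal_dense3 by blast
      from ereal_dense3[OF b(1)] obtain a :: rat where
        "liminf (\<lambda>n. ?A n x) < real_of_rat a" "ereal (real_of_rat a) < real_of_rat b" by blast
      then show False using * b(2) by (force simp: of_rat_less)
    qed
    then have eq: "liminf (\<lambda>n. ?A n x) = limsup (\<lambda>n. ?A n x)"
      by (simp add: Liminf_le_Limsup order.antisym not_less)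
    have bd: "\<bar>?A n x\<bar> \<le> K" for n
    proof -
      have "\<bar>\<Sum>k<n. \<phi> ((T ^^ k) x)\<bar> \<le> (\<Sum>k<n. K)"
        by (intro order_trans[OF sum_abs] sum_mono K orbit)
      then show ?thesis using K[OF x] by (cases "n = 0") (auto simp: birkhoff_average_def field_simps)
    qed
    \<comment> \<open>The bound \<open>K\<close> excludes infinite values of the common
      limit.\<close>
    have "limsup (\<lambda>n. ?A n x) \<le> K"
      by (rule Limsup_bounded) (use bd[THEN abs_le_D1] in simp)
    moreover have "- K \<le> ?A n x" for n using bd[of n] by linarith
    then have "- K \<le> liminf (\<lambda>n. ?A n x)" by (intro Liminf_bounded) simp
    ultimately obtain l where "limsup (\<lambda>n. ?A n x) = ereal l"
      using eq by (cases "limsup (\<lambda>n. ?A n x)") auto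
    with eq have "(\<lambda>n. ereal (?A n x)) \<longlonglongrightarrow> ereal l"
      by (subst tendsto_iff_Liminf_eq_Limsup) simp_all
    then show "convergent (\<lambda>n. ?A n x)" by (auto simp: convergent_def)
  qed
qed

section \<open>The torus as a measure space\<close>

lemma compact_torus: "compact (UNIV :: torus set)"
proof -
  have "a \<in> torus_proj ` cbox 0 1" for a
  proof -
    obtain x where a: "a = torus_proj x" by (rule torus_proj_cases)
    have "a = torus_proj (\<chi> i. frac (x $ i))"
      by (simp add: a torus_proj_eq_iff frac_def)
    moreover have "(\<chi> i. frac (x $ i)) \<in> cbox 0 1"
      by (simp add: mem_box_cart less_imp_le[OF frac_lt_1])
    ultimately show ?thesis by blast
  qed
  then have "UNIV = torus_proj ` cbox 0 1" by blast
  then show ?thesis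
    by (metis compact_cbox compact_continuous_image continuous_on_torus_proj)
qed

lemma space_torus_lborel [simp]: "space torus_lborel = UNIV"
  and sets_torus_lborel [simp, measurable_cong]: "sets torus_lborel = sets borel"
  by (simp_all add: torus_lborel_def)

lemma finite_measure_torus_lborel: "finite_measure torus_lborel"
proof
  have "emeasure torus_lborel UNIV \<le> emeasure lborel (cbox (0 :: real^2) 1)"
    by (subst emeasure_torus_lborel) (auto intro!: emeasure_mono simp: mem_box_cart less_imp_le)
  also have "\<dots> < \<infinity>" by (rule emeasure_lborel_cbox_finite)
  finally show "emeasure torus_lborel (space torus_lborel) \<noteq> \<infinity>" by simp
qed

text \<open>The preimage of \<open>V\<close> is open and meets the closed unit square, hence also
  the open one. There it is a nonempty open subset of the half-open fundamental domain.\<close>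

lemma emeasure_torus_lborel_open_pos:
  assumes "open V" "V \<noteq> {}" shows "emeasure torus_lborel V \<noteq> 0"
proof
  assume "emeasure torus_lborel V = 0"
  then have 0: "emeasure lborel (torus_proj -` V \<inter> {x. \<forall>i. 0 \<le> x $ i \<and> x $ i < 1}) = 0"
    using assms(1) by (simp add: emeasure_torus_lborel)
  let ?W = "torus_proj -` V \<inter> box 0 1"
  obtain x where x: "torus_proj x \<in> V" using assms(2) torus_proj_cases by (metis all_not_in_conv)
  have "torus_proj (\<chi> i. frac (x $ i)) = torus_proj x"
    by (simp add: torus_proj_eq_iff frac_def)
  moreover have "(\<chi> i. frac (x $ i)) \<in> cbox 0 1"
    by (simp add: mem_box_cart less_imp_le[OF frac_lt_1])
  moreover have "closure (box 0 1) = cbox 0 (1 :: real^2)"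
    by (rule closure_box) (simp add: interval_ne_empty_cart)
  ultimately have "torus_proj -` V \<inter> closure (box 0 1) \<noteq> {}" using x by auto
  moreover have op: "open (torus_proj -` V)" using assms(1) by (simp add: open_torus_iff)
  ultimately have "?W \<noteq> {}" by (simp add: open_Int_closure_eq_empty)
  moreover have "open ?W" using op by (intro open_Int open_box)
  ultimately have "emeasure lborel ?W \<noteq> 0"
    using open_not_negligible[of ?W] by (auto simp: negligible_iff_emeasure0)
  moreover have "emeasure lborel ?W \<le>
      emeasure lborel (torus_proj -` V \<inter> {x. \<forall>i. 0 \<le> x $ i \<and> x $ i < 1})"
  proof (rule emeasure_mono)
    have "torus_proj -` V \<in> sets borel" using op by simp
    then show "torus_proj -` V \<inter> {x. \<forall>i. 0 \<le> x $ i \<and> x $ i < 1} \<in> sets lborel"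
      by measurable
  qed (auto simp: mem_box_cart less_imp_le)
  ultimately show False using 0 by simp
qed

text \<open>A coordinate of the displacement of \<open>F\<close> descends to a continuous function
  on the compact torus, which is therefore bounded. Its Birkhoff averages converge almost
  everywhere, in particular somewhere on the projection of \<open>S\<close>, which has positive
  measure.\<close>

lemma area_preserving_velocity_converges:
  assumes f: "homeo0 f" and lift: "lift_of F f" and area: "area_preserving f"
    and S: "open S" "S \<noteq> {}"
  obtains y l where "y \<in> S" "(\<lambda>n. ((F ^^ n) y - y) $ i / real n) \<longlonglongrightarrow> l"
proof -
  define \<phi> where "\<phi> a = (F (torus_rep a) - torus_rep a) $ i" for a
  have \<phi>: "\<phi> (torus_proj x) = (F x - x) $ i" for x
  proof -
    let ?v = "torus_rep (torus_proj x) - x"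
    have "torus_proj (torus_rep (torus_proj x)) = torus_proj x"
      by (rule Quotient3_abs_rep[OF Quotient3_torus])
    then have "\<And>i. ?v $ i \<in> \<int>" by (simp add: torus_proj_eq_iff)
    from lift_add_int[OF f lift this, of x] show ?thesis by (simp add: \<phi>_def)
  qed
  have contF: "continuous_on UNIV F" using lift by (simp add: lift_of_def)
  have cont: "continuous_on UNIV \<phi>"
    unfolding continuous_on_torus_iff using contF
    by (simp add: comp_def \<phi> del: vector_minus_component) (intro continuous_intros)
  have "bounded (range \<phi>)"
    by (intro compact_imp_bounded compact_continuous_image cont compact_torus)
  then obtain K where K: "\<And>a. \<bar>\<phi> a\<bar> \<le> K" by (auto simp: bounded_iff)
  have contf: "continuous_on UNIV f" using f by (auto simp: homeo0_def homeomorphism_def)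
  then have meas: "f \<in> torus_lborel \<rightarrow>\<^sub>M torus_lborel"
    by (simp add: borel_measurable_continuous_onI cong: measurable_cong_sets)
  have "distr torus_lborel torus_lborel f = torus_lborel"
    using area by (intro measure_eqI) (auto simp: emeasure_distr[OF meas] area_preserving_def)
  then have AE: "AE a in torus_lborel. convergent (\<lambda>n. birkhoff_average f \<phi> n a)"
    using cont K
    by (intro birkhoff_bounded[OF finite_measure_torus_lborel meas])
      (auto simp: borel_measurable_continuous_onI cong: measurable_cong_sets)
  let ?V = "torus_proj ` S"
  have V: "open ?V" using S(1) by (rule open_torus_proj_image)
  have "\<exists>a\<in>?V. convergent (\<lambda>n. birkhoff_average f \<phi> n a)"
  proof (rule ccontr)
    assume "\<not> ?thesis"
    with AE have "AE a in torus_lborel. a \<notin> ?V" by (auto elim: eventually_mono)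
    then have "emeasure torus_lborel ?V = 0"
      using V by (subst (asm) AE_iff_measurable[of ?V]) auto
    then show False using emeasure_torus_lborel_open_pos[OF V] S(2) by simp
  qed
  then obtain y where y: "y \<in> S" "convergent (\<lambda>n. birkhoff_average f \<phi> n (torus_proj y))"
    by blast
  \<comment> \<open>The displacements of successive steps telescope.\<close>
  have "(\<Sum>k<n. \<phi> ((f ^^ k) (torus_proj y))) = ((F ^^ n) y - y) $ i" for n
  proof (induction n)
    case (Suc n)
    have "(f ^^ n) (torus_proj y) = torus_proj ((F ^^ n) y)"
      using lift_of_proj[OF lift_of_funpow[OF lift]] by simp
    with Suc show ?case by (simp add: \<phi>)
  qed simp
  then show ?thesis
    using y that by (auto simp: birkhoff_average_def convergent_def)
qed

section \<open>Recurrence and Lyapunov stability\<close>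

text \<open>Non-wandering alone gives a return time of at least 1. Long return times arise by
  applying it to the smaller open set of points that already return after \<open>n\<close> steps: a
  return to that set after \<open>m\<close> steps is followed by a return to \<open>V\<close> after
  \<open>n\<close> more.\<close>

lemma nonwandering_return:
  assumes f: "nonwandering f" "continuous_on UNIV f" and "open V" "V \<noteq> {}"
  shows "\<exists>n\<ge>N. \<exists>y\<in>V. (f ^^ n) y \<in> V"
proof (induction N)
  case 0
  from \<open>V \<noteq> {}\<close> obtain y where "y \<in> V" by blast
  then have "(f ^^ 0) y \<in> V" by simp
  with \<open>y \<in> V\<close> show ?case by blast
next
  case (Suc N)
  then obtain n y where ny: "n \<ge> N" "y \<in> V" "(f ^^ n) y \<in> V" by blast
  have "continuous_on UNIV (f ^^ n)"
    by (rule continuous_on_funpow[OF f(2)])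
  then have "open (V \<inter> (f ^^ n) -` V)"
    using \<open>open V\<close> by (intro open_Int open_vimage)
  moreover have "y \<in> V \<inter> (f ^^ n) -` V" using ny by simp
  ultimately have "\<not> wandering_set f (V \<inter> (f ^^ n) -` V)"
    using f(1) by (auto simp: nonwandering_def wandering_point_def)
  then obtain m w where m: "m \<ge> 1" "w \<in> V" "(f ^^ n) ((f ^^ m) w) \<in> V"
    by (auto simp: wandering_set_def)
  then have "(f ^^ (n + m)) w \<in> V" by (simp add: funpow_add)
  moreover have "n + m \<ge> Suc N" using m(1) ny(1) by simp
  ultimately show ?case using m(2) by blast
qed

text \<open>If \<open>b\<close> is additive up to a bounded error along arbitrarily long steps \<open>n\<close>, then \<open>b m\<close> differs from
  \<open>(m / n) v\<close> by at most \<open>C m / n\<close> up to a constant.\<close>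

lemma convergent_if_almost_periodic_increments:
  fixes b :: "nat \<Rightarrow> 'a::banach"
  assumes b: "\<And>N. \<exists>n\<ge>N. \<exists>v. \<forall>m. norm (b (n + m) - b m - v) \<le> C"
  shows "convergent (\<lambda>m. b m /\<^sub>R real m)"
proof -
  have "C \<ge> 0" using b[of 0] norm_ge_zero order_trans by blast
  have "Cauchy (\<lambda>m. b m /\<^sub>R real m)"
  proof (rule metric_CauchyI)
    fix e :: real assume "e > 0"
    obtain N where N: "real N > 4 * C / e" "N \<ge> 1"
      by (metis reals_Archimedean2 max.cobounded2 max.strict_coboundedI1 of_nat_1 of_nat_le_iff of_nat_max)
    from b[of N] obtain n v where n: "n \<ge> N" "\<And>m. norm (b (n + m) - b m - v) \<le> C" by blast
    have "n \<ge> 1" using n(1) N(2) by simp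
    have Cn: "C / real n < e / 4"
    proof -
      have "4 * C / e < real n" using N(1) n(1) by linarith
      then show ?thesis using \<open>e > 0\<close> \<open>n \<ge> 1\<close> by (simp add: field_simps)
    qed
    \<comment> \<open>The deviation of \<open>b\<close> from linear growth with slope
      \<open>v / n\<close>. It is at most \<open>B\<close> on the first block of length
      \<open>n\<close>, and each further block adds at most \<open>C\<close>.\<close>
    define c where "c m = b m - (real m / real n) *\<^sub>R v" for m
    define B where "B = (\<Sum>r<n. norm (c r))"
    have c: "norm (c m) \<le> B + C * (real m / real n)" for m
    proof (induction m rule: less_induct)
      case (less m)
      show ?case
      proof (cases "m < n")
        case True
        then have "norm (c m) \<le> B" unfolding B_def by (intro member_le_sum) auto
        moreover have "0 \<le> C * (real m / real n)" using \<open>C \<ge> 0\<close> by simp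
        ultimately show ?thesis by linarith
      next
        case False
        then obtain k where k: "m = n + k" by (metis le_Suc_ex not_less)
        have "(real m / real n) *\<^sub>R v = v + (real k / real n) *\<^sub>R v"
          using \<open>n \<ge> 1\<close> by (simp add: k add_divide_distrib scaleR_add_left)
        then have "c m = c k + (b (n + k) - b k - v)" by (simp add: c_def k)
        then have "norm (c m) \<le> norm (c k) + C"
          using n(2)[of k] norm_triangle_ineq[of "c k" "b (n + k) - b k - v"] by simp
        also have "\<dots> \<le> B + C * (real k / real n) + C" using less[of k] k \<open>n \<ge> 1\<close> by simp
        also have "\<dots> = B + C * (real m / real n)"
          using \<open>n \<ge> 1\<close> by (simp add: k field_simps)
        finally show ?thesis .
      qed
    qed
    obtain M where M: "real M > 4 * B / e" "M \<ge> 1"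
      by (metis reals_Archimedean2 max.cobounded2 max.strict_coboundedI1 of_nat_1 of_nat_le_iff of_nat_max)
    \<comment> \<open>The slope \<open>v / n\<close> depends on \<open>e\<close>; it serves as a
      common centre within \<open>e / 2\<close> of all late terms. One quarter of \<open>e\<close>
      is spent on \<open>B / m\<close> and one on \<open>C / n\<close>.\<close>
    have close: "dist (b m /\<^sub>R real m) (v /\<^sub>R real n) < e / 2" if "m \<ge> M" for m
    proof -
      have "m \<ge> 1" using that M(2) by simp
      have "4 * B / e < real m" using M(1) that by linarith
      then have Bm: "B / real m < e / 4" using \<open>e > 0\<close> \<open>m \<ge> 1\<close> by (simp add: field_simps)
      have "b m /\<^sub>R real m - v /\<^sub>R real n = c m /\<^sub>R real m"
        using \<open>m \<ge> 1\<close> by (simp add: c_def scaleR_diff_right field_simps)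
      then have "dist (b m /\<^sub>R real m) (v /\<^sub>R real n) = norm (c m) / real m"
        by (simp add: dist_norm divide_inverse mult.commute)
      also have "\<dots> \<le> (B + C * (real m / real n)) / real m" by (intro divide_right_mono c) simp
      also have "\<dots> = B / real m + C / real n" using \<open>m \<ge> 1\<close> by (simp add: field_simps)
      finally show ?thesis using Bm Cn by linarith
    qed
    show "\<exists>M. \<forall>m\<ge>M. \<forall>n\<ge>M. dist (b m /\<^sub>R real m) (b n /\<^sub>R real n) < e"
      using close dist_triangle_half_l by blast
  qed
  then show ?thesis by (rule Cauchy_convergent)
qed

text \<open>The balls of radius \<open>1/2\<close> around the points of a fibre are pairwise disjoint.\<close>

lemma connected_subset_ball_half:
  assumes "connected S" "a \<in> S"
    and S: "\<And>y. y \<in> S \<Longrightarrow> dist (torus_proj y) (torus_proj a) < 1/2"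
  shows "S \<subseteq> ball a (1/2)"
proof -
  define B where "B = (\<Union>v\<in>{v. (\<forall>i. v $ i \<in> \<int>) \<and> v \<noteq> 0}. ball (a + v) (1/2))"
  have sub: "S \<subseteq> ball a (1/2) \<union> B"
  proof
    fix y assume "y \<in> S"
    have ne: "torus_proj -` {torus_proj y} \<noteq> {}" by auto
    have "infdist a (torus_proj -` {torus_proj y}) < 1/2"
      using S[OF \<open>y \<in> S\<close>] by (simp add: dist_commute flip: dist_torus_proj)
    \<comment> \<open>The infimum over the fibre of \<open>y\<close> is below 1/2, so some
      representative \<open>p\<close> is that close to \<open>a\<close>. Translating by
      \<open>y - p\<close> puts \<open>y\<close> into the ball around another point of the fibre of
      \<open>a\<close>, unless \<open>y = p\<close>.\<close>
    then obtain p where p: "torus_proj p = torus_proj y" "dist a p < 1/2"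
      unfolding infdist_notempty[OF ne] by (subst (asm) cINF_less_iff[OF ne]) auto
    have "\<forall>i. (y - p) $ i \<in> \<int>" using p(1)[symmetric] by (simp add: torus_proj_eq_iff)
    have "y \<in> ball (a + (y - p)) (1/2)"
      using p(2) by (simp add: dist_norm algebra_simps)
    show "y \<in> ball a (1/2) \<union> B"
    proof (cases "y = p")
      case False
      then have "y - p \<in> {v. (\<forall>i. v $ i \<in> \<int>) \<and> v \<noteq> 0}"
        using \<open>\<forall>i. (y - p) $ i \<in> \<int>\<close> by simp
      then have "y \<in> B"
        unfolding B_def using \<open>y \<in> ball (a + (y - p)) (1/2)\<close> by (rule UN_I)
      then show ?thesis ..
    qed (use p(2) in simp)
  qed
  have disj: "ball a (1/2) \<inter> B = {}"
  proof -
    \<comment> \<open>If two such balls met, \<open>v\<close> would be a nonzero integer vector of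
      norm below 1.\<close>
    have False if "dist a y < 1/2" "dist (a + v) y < 1/2" "\<forall>i. v $ i \<in> \<int>" "v \<noteq> 0" for y v
    proof -
      have "dist (a + v) a < 1"
        using that(1,2) dist_triangle_half_l[of "a + v" y 1 a] by (simp add: dist_commute)
      then have "norm v < 1" by (simp add: dist_norm)
      then have small: "\<bar>v $ i\<bar> < 1" for i using component_le_norm_cart[of v i] by linarith
      have "v $ i = 0" for i
        using Ints_nonzero_abs_ge1[OF that(3)[rule_format, of i]] small[of i] by linarith
      then show False using \<open>v \<noteq> 0\<close> by (simp add: vec_eq_iff)
    qed
    then show ?thesis by (auto simp: B_def)
  qed
  have "open B" unfolding B_def by auto
  then have "ball a (1/2) \<inter> S = {} \<or> B \<inter> S = {}"
    using connectedD[OF assms(1) open_ball, of B a "1/2"] sub disj by blast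
  moreover have "a \<in> ball a (1/2) \<inter> S" using assms(2) by simp
  ultimately show ?thesis using sub by blast
qed

text \<open>Stability bounds distances only up to integer translations. The image of the ball under
  \<open>F ^^ n\<close> is connected, so it cannot leave the ball of radius 1/2 around the iterate
  of its centre for one around a translate.\<close>

lemma stable_iterates_stay_close:
  assumes lift: "lift_of F f"
    and stable: "\<And>n. (f ^^ n) ` ball (torus_proj x) \<delta> \<subseteq> ball ((f ^^ n) (torus_proj x)) (1/2)"
    and y: "y \<in> ball x \<delta>"
  shows "dist ((F ^^ n) x) ((F ^^ n) y) < 1/2"
proof -
  have lift_n: "lift_of (F ^^ n) (f ^^ n)" using lift by (rule lift_of_funpow)
  have "0 < \<delta>" using y by (metis ball_empty empty_iff not_less)
  have "(F ^^ n) ` ball x \<delta> \<subseteq> ball ((F ^^ n) x) (1/2)"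
  proof (rule connected_subset_ball_half)
    show "connected ((F ^^ n) ` ball x \<delta>)"
      using lift_n by (intro connected_continuous_image)
        (auto simp: lift_of_def intro: continuous_on_subset)
    show "(F ^^ n) x \<in> (F ^^ n) ` ball x \<delta>" using \<open>0 < \<delta>\<close> by simp
    fix w assume "w \<in> (F ^^ n) ` ball x \<delta>"
    then obtain u where u: "w = (F ^^ n) u" "dist x u < \<delta>" by auto
    then have "torus_proj u \<in> ball (torus_proj x) \<delta>"
      using dist_torus_proj_le[of x u] by simp
    then have "(f ^^ n) (torus_proj u) \<in> ball ((f ^^ n) (torus_proj x)) (1/2)"
      using stable[of n] by blast
    then show "dist (torus_proj w) (torus_proj ((F ^^ n) x)) < 1/2"
      by (simp add: u(1) lift_of_proj[OF lift_n] dist_commute)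
  qed
  then have "(F ^^ n) y \<in> ball ((F ^^ n) x) (1/2)" using y by blast
  then show ?thesis by simp
qed

lemma nonwandering_stable_not_chaotic:
  assumes f: "homeo0 f" and lift: "lift_of F f" and nonw: "nonwandering f"
    and stable: "lyapunov_stable (1/2) f z"
  shows "z \<notin> chaotic_region F"
proof -
  obtain x where z: "z = torus_proj x" by (rule torus_proj_cases)
  from stable obtain \<delta> where "\<delta> > 0"
    and \<delta>: "\<And>n. (f ^^ n) ` ball (torus_proj x) \<delta> \<subseteq> ball ((f ^^ n) (torus_proj x)) (1/2)"
    unfolding lyapunov_stable_def z by blast
  note F = lift_add_int[OF f lift]
  have close: "dist ((F ^^ n) x) ((F ^^ n) y) < 1/2" if "y \<in> ball x \<delta>" for n y
    using lift \<delta> that by (rule stable_iterates_stay_close)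
  have contf: "continuous_on UNIV f" using f by (auto simp: homeo0_def homeomorphism_def)
  have "\<exists>n\<ge>N. \<exists>v. \<forall>m. norm ((F ^^ (n + m)) x - (F ^^ m) x - v) \<le> 1" for N
  proof -
    have "open (torus_proj ` ball x \<delta>)" "torus_proj ` ball x \<delta> \<noteq> {}"
      using \<open>\<delta> > 0\<close> by (auto intro: open_torus_proj_image)
    from nonwandering_return[OF nonw contf this, of N] obtain n w u where
      n: "n \<ge> N" and w: "w \<in> ball x \<delta>" and u: "u \<in> ball x \<delta>"
      and "(f ^^ n) (torus_proj w) = torus_proj u" by blast
    then have wu: "torus_proj ((F ^^ n) w) = torus_proj u"
      by (simp add: lift_of_proj[OF lift_of_funpow[OF lift]])
    \<comment> \<open>The integer translation of the return. Since \<open>w\<close> reaches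
      \<open>u + v\<close> at time \<open>n\<close>, its later orbit is that of \<open>u\<close>
      translated by \<open>v\<close>; replacing \<open>w\<close> and \<open>u\<close> by the centre
      \<open>x\<close> costs 1/2 each.\<close>
    define v where "v = (F ^^ n) w - u"
    have v: "\<And>i. v $ i \<in> \<int>" using wu by (simp add: v_def torus_proj_eq_iff)
    have "norm ((F ^^ (n + m)) x - (F ^^ m) x - v) \<le> 1" for m
    proof -
      have "(F ^^ (n + m)) w = (F ^^ m) ((F ^^ n) w)"
        by (metis add.commute comp_apply funpow_add)
      also have "\<dots> = (F ^^ m) u + v"
        using lift_funpow_add_int[OF F v, of m u] by (simp add: v_def)
      finally have "(F ^^ (n + m)) x - (F ^^ m) x - v
          = ((F ^^ (n + m)) x - (F ^^ (n + m)) w) + ((F ^^ m) u - (F ^^ m) x)" by simp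
      then have "norm ((F ^^ (n + m)) x - (F ^^ m) x - v)
          \<le> dist ((F ^^ (n + m)) x) ((F ^^ (n + m)) w) + dist ((F ^^ m) x) ((F ^^ m) u)"
        by (metis dist_commute dist_norm norm_triangle_ineq)
      also have "\<dots> \<le> 1" using close[OF w, of "n + m"] close[OF u, of m] by simp
      finally show ?thesis .
    qed
    with n show ?thesis by blast
  qed
  then have "convergent (\<lambda>m. (F ^^ m) x /\<^sub>R real m)"
    by (rule convergent_if_almost_periodic_increments)
  then obtain \<rho> where \<rho>: "(\<lambda>m. (F ^^ m) x /\<^sub>R real m) \<longlonglongrightarrow> \<rho>" by (auto simp: convergent_def)
  have "(\<lambda>m. ((F ^^ m) x /\<^sub>R real m) $ 1 - x $ 1 / real m) \<longlonglongrightarrow> \<rho> $ 1 - 0"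
    by (intro tendsto_diff tendsto_vec_nth \<rho> lim_const_over_n)
  then have lim: "(\<lambda>m. ((F ^^ m) x - x) $ 1 / real m) \<longlonglongrightarrow> \<rho> $ 1"
    by (simp add: diff_divide_distrib divide_inverse mult.commute right_diff_distrib)
  show ?thesis unfolding z
  \<comment> \<open>Both points stay within 1/2 of the orbit of \<open>x\<close>, so the constant 1
    bounds the separation.\<close>
  proof (rule not_chaotic_if_sublinear[OF F \<open>\<delta> > 0\<close> _ _ _ lim, where d = "\<lambda>_. 1"])
    show "x \<in> ball x \<delta>" using \<open>\<delta> > 0\<close> by simp
    show "(\<lambda>n. 1 / real n) \<longlonglongrightarrow> 0" by (rule lim_const_over_n)
    show "dist ((F ^^ n) y) ((F ^^ n) w) \<le> 1" if "y \<in> ball x \<delta>" "w \<in> ball x \<delta>" for n y w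
      using close[OF that(1), of n] close[OF that(2), of n]
        dist_triangle[of "(F ^^ n) y" "(F ^^ n) w" "(F ^^ n) x"] by (simp add: dist_commute)
  qed
qed

section \<open>Growth of bounded neighbourhoods\<close>

text \<open>If the images of two components meet, an integer translation carries one component into
  the other. Hence the image of \<open>C\<close> and the union of the images disjoint from it form
  an open partition of \<open>U\<close>, and connectedness leaves only the first. So every component
  has a point in each fibre over \<open>U\<close>.\<close>

lemma torus_proj_component_image:
  assumes "open U" "connected U" "C \<in> components (torus_proj -` U)"
  shows "torus_proj ` C = U"
proof -
  let ?P = "torus_proj -` U"
  let ?A = "torus_proj ` C"
  let ?B = "\<Union>D\<in>{D \<in> components ?P. torus_proj ` D \<inter> ?A = {}}. torus_proj ` D"
  have P: "open ?P" using assms(1) by (simp add: open_torus_iff)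
  have comp_open: "open (torus_proj ` D)" if "D \<in> components ?P" for D
    using open_components[OF P that] by (rule open_torus_proj_image)
  have dich: "torus_proj ` D \<subseteq> ?A" if D: "D \<in> components ?P" and meet: "torus_proj ` D \<inter> ?A \<noteq> {}" for D
  proof -
    from meet obtain p q where p: "p \<in> D" and q: "q \<in> C" and pq: "torus_proj p = torus_proj q" by auto
    define v where "v = q - p"
    have "\<And>i. v $ i \<in> \<int>" using pq[symmetric] by (simp add: v_def torus_proj_eq_iff)
    then have v: "torus_proj (v + x) = torus_proj x" for x
      using torus_proj_add_int[of v x] by (simp add: add.commute)
    have "(+) v ` D \<subseteq> C"
    proof (rule components_maximal[OF assms(3)])
      show "connected ((+) v ` D)"
        by (rule connected_continuous_image[OF _ in_components_connected[OF D]])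
          (rule continuous_on_add[OF continuous_on_const continuous_on_id])
      show "(+) v ` D \<subseteq> ?P" using in_components_subset[OF D] by (auto simp: v)
      have "q = v + p" by (simp add: v_def)
      then have "q \<in> (+) v ` D" using p by (rule image_eqI)
      with q show "C \<inter> (+) v ` D \<noteq> {}" by blast
    qed
    then have "torus_proj ` (+) v ` D \<subseteq> ?A" by blast
    then show ?thesis by (simp add: image_image v)
  qed
  have AU: "?A \<subseteq> U" using in_components_subset[OF assms(3)] by auto
  have cover: "U \<subseteq> ?A \<union> ?B"
  proof
    fix a assume "a \<in> U"
    obtain x where a: "a = torus_proj x" by (rule torus_proj_cases)
    with \<open>a \<in> U\<close> have "x \<in> \<Union>(components ?P)" by simp
    then obtain D where D: "D \<in> components ?P" "a \<in> torus_proj ` D" unfolding a by blast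
    show "a \<in> ?A \<union> ?B"
    proof (cases "torus_proj ` D \<inter> ?A = {}")
      case True
      with D have "a \<in> ?B" by (intro UN_I[of D]) auto
      then show ?thesis ..
    next
      case False
      then show ?thesis using dich[OF D(1)] D(2) by (intro UnI1) (rule subsetD)
    qed
  qed
  have "open ?B" by (intro open_UN ballI comp_open) simp
  moreover have "?A \<inter> ?B \<inter> U = {}" by auto
  ultimately have "?A \<inter> U = {} \<or> ?B \<inter> U = {}"
    using cover by (intro connectedD[OF assms(2) comp_open[OF assms(3)]])
  moreover have "?A \<inter> U = ?A" using AU by (rule Int_absorb2)
  moreover have "?A \<noteq> {}" using in_components_nonempty[OF assms(3)] by simp
  ultimately have "U \<inter> ?B = {}" by (simp add: Int_commute)
  moreover have "V \<subseteq> A" if "V \<subseteq> A \<union> B" "V \<inter> B = {}" for A B V :: "torus set"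
    using that by blast
  ultimately have "U \<subseteq> ?A" using cover by simp
  with AU show ?thesis by (rule equalityI)
qed

text \<open>Otherwise the diameters grow sublinearly. As \<open>C\<close> contains a ball around a
  lift of \<open>z\<close>, they can serve as the bound \<open>d\<close> of the criterion, and area
  preservation provides an orbit in that ball with a convergent velocity coordinate.\<close>

lemma area_preserving_chaotic_diameter:
  assumes f: "homeo0 f" and lift: "lift_of F f" and area: "area_preserving f"
    and z: "z \<in> chaotic_region F" "z \<in> interior U" "z \<in> torus_proj ` C"
    and C: "C \<in> components (torus_proj -` U)" "bounded C"
  shows "limsup (\<lambda>n. ereal (diameter ((F ^^ n) ` C) / real n)) > 0"
proof (rule ccontr)
  let ?d = "\<lambda>n. diameter ((F ^^ n) ` C)"
  assume "\<not> ?thesis"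
  then have le0: "limsup (\<lambda>n. ereal (?d n / real n)) \<le> 0" by simp
  \<comment> \<open>Boundedness makes \<open>diameter\<close> a genuine bound on distances, as it is
    the supremum of a bounded set; it follows from compactness of the closure of
    \<open>C\<close>.\<close>
  have bdd: "bounded ((F ^^ n) ` C)" for n
  proof -
    have "continuous_on (closure C) (F ^^ n)"
      using lift_of_funpow[OF lift] by (auto simp: lift_of_def intro: continuous_on_subset)
    then have "compact ((F ^^ n) ` closure C)"
      using C(2) by (intro compact_continuous_image) (simp_all add: compact_closure)
    then show ?thesis
      by (rule bounded_subset[OF compact_imp_bounded]) (simp add: closure_subset image_mono)
  qed
  have "0 \<le> liminf (\<lambda>n. ereal (?d n / real n))"
    by (rule Liminf_bounded) (simp add: diameter_ge_0[OF bdd])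
  moreover have "liminf (\<lambda>n. ereal (?d n / real n)) \<le> limsup (\<lambda>n. ereal (?d n / real n))"
    by (rule Liminf_le_Limsup) simp
  ultimately have "(\<lambda>n. ereal (?d n / real n)) \<longlonglongrightarrow> ereal 0"
    using le0 by (subst tendsto_iff_Liminf_eq_Limsup) (auto simp: zero_ereal_def[symmetric])
  then have d0: "(\<lambda>n. ?d n / real n) \<longlonglongrightarrow> 0" by simp
  from z(3) obtain x where x: "z = torus_proj x" "x \<in> C" by blast
  have "open (torus_proj -` interior U)"
    using open_torus_iff[of "interior U"] by simp
  then obtain r where r: "r > 0" "ball x r \<subseteq> torus_proj -` interior U"
    using z(2) x(1) by (metis openE vimageI2)
  \<comment> \<open>The ball is connected, lies over \<open>U\<close> and meets \<open>C\<close> in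
    \<open>x\<close>.\<close>
  have sub: "ball x r \<subseteq> C"
  proof (rule components_maximal[OF C(1)])
    show "ball x r \<subseteq> torus_proj -` U" using r(2) interior_subset by blast
    have "x \<in> C \<inter> ball x r" using x(2) r(1) by simp
    then show "C \<inter> ball x r \<noteq> {}" by blast
  qed simp
  from r(1) have "ball x r \<noteq> {}" by simp
  then obtain y l where y: "y \<in> ball x r" "(\<lambda>n. ((F ^^ n) y - y) $ 1 / real n) \<longlonglongrightarrow> l"
    by (rule area_preserving_velocity_converges[OF f lift area open_ball])
  have "torus_proj x \<notin> chaotic_region F"
  proof (rule not_chaotic_if_sublinear[OF lift_add_int[OF f lift] r(1) y(1) _ _ y(2)])
    show "(\<lambda>n. ?d n / real n) \<longlonglongrightarrow> 0" by fact
    show "dist ((F ^^ n) y) ((F ^^ n) w) \<le> ?d n" if "y \<in> ball x r" "w \<in> ball x r" for n y w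
      using that sub by (intro diameter_bounded_bound[OF bdd]) auto
  qed
  then show False using z(1) x(1) by simp
qed

text \<open>In the second part, an open \<open>U\<close> admits every component of its preimage,
  since each contains a lift of \<open>z\<close>. For a neighbourhood that is not open, the
  component is taken to be one that contains a lift of \<open>z\<close>.\<close>

theorem proposition1p5:
  fixes f :: "torus \<Rightarrow> torus" and F :: "real^2 \<Rightarrow> real^2"
  assumes "homeo0 f" and "lift_of F f" and "interior (rotation_set F) \<noteq> {}"
  shows "(nonwandering f \<longrightarrow> (\<forall>z \<in> chaotic_region F. \<not> lyapunov_stable (1/2) f z)) \<and>
    (area_preserving f \<longrightarrow>
      (\<forall>z U U'. z \<in> chaotic_region F \<and> z \<in> interior U \<and> connected U \<and> torus_bounded U \<and>
          U' \<in> components (torus_proj -` U) \<and> (open U \<or> z \<in> torus_proj ` U') \<longrightarrow>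
        limsup (\<lambda>n. ereal (diameter ((F ^^ n) ` U') / real n)) > 0))"
proof (intro conjI impI allI)
  assume "nonwandering f"
  then show "\<forall>z \<in> chaotic_region F. \<not> lyapunov_stable (1/2) f z"
    using nonwandering_stable_not_chaotic[OF assms(1,2)] by blast
next
  fix z U U'
  assume area: "area_preserving f"
    and *: "z \<in> chaotic_region F \<and> z \<in> interior U \<and> connected U \<and> torus_bounded U \<and>
      U' \<in> components (torus_proj -` U) \<and> (open U \<or> z \<in> torus_proj ` U')"
  then have "z \<in> torus_proj ` U'"
    using torus_proj_component_image[of U U'] interior_subset by blast
  with * show "limsup (\<lambda>n. ereal (diameter ((F ^^ n) ` U') / real n)) > 0"
    by (intro area_preserving_chaotic_diameter[OF assms(1,2) area]) (auto simp: torus_bounded_def)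
qed

end
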